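(* There exists a $4$-connected graph of (orientable) genus at most $39$ that contains no HIST.
   Context: A HIST of a graph is a spanning tree in which no vertex has degree $2$. The (orientable) genus of a graph $G$ is the smallest integer $g \ge 0$ such that $G$ embeds in the orientable surface of genus $g$. *)

theory Defs
  imports "HOL-Analysis.Analysis" "HOL-Library.Extended_Nat"
begin

section \<open>Finite simple graphs\<close>

text \<open>A graph is given by its vertex set and its set of edges, an edge being the
  two-element set of its endpoints.\<close>

definition simple_graph :: "'v set \<Rightarrow> 'v set set \<Rightarrow> bool" where
  "simple_graph V E \<longleftrightarrow> finite V \<and> (\<forall>e\<in>E. e \<subseteq> V \<and> card e = 2)"

definition degree :: "'v set set \<Rightarrow> 'v \<Rightarrow> nat" where
  "degree E v = card {e \<in> E. v \<in> e}"

definition graph_connected :: "'v set \<Rightarrow> 'v set set \<Rightarrow> bool" where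
  "graph_connected V E \<longleftrightarrow>
     V \<noteq> {} \<and> (\<forall>u\<in>V. \<forall>v\<in>V. (u, v) \<in> {(x, y). {x, y} \<in> E}\<^sup>*)"

definition k_connected :: "nat \<Rightarrow> 'v set \<Rightarrow> 'v set set \<Rightarrow> bool" where
  "k_connected k V E \<longleftrightarrow>
     k < card V \<and>
     (\<forall>S. S \<subseteq> V \<and> card S < k \<longrightarrow> graph_connected (V - S) {e \<in> E. e \<subseteq> V - S})"

definition is_cycle :: "'v set set \<Rightarrow> 'v list \<Rightarrow> bool" where
  "is_cycle E c \<longleftrightarrow>
     3 \<le> length c \<and> distinct c \<and>
     (\<forall>i < length c. {c ! i, c ! (Suc i mod length c)} \<in> E)"

definition is_tree :: "'v set \<Rightarrow> 'v set set \<Rightarrow> bool" where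
  "is_tree V T \<longleftrightarrow> simple_graph V T \<and> graph_connected V T \<and> (\<nexists>c. is_cycle T c)"

definition spanning_tree :: "'v set \<Rightarrow> 'v set set \<Rightarrow> 'v set set \<Rightarrow> bool" where
  "spanning_tree V E T \<longleftrightarrow> T \<subseteq> E \<and> is_tree V T"

definition HIST :: "'v set \<Rightarrow> 'v set set \<Rightarrow> 'v set set \<Rightarrow> bool" where
  "HIST V E T \<longleftrightarrow> spanning_tree V E T \<and> (\<forall>v\<in>V. degree T v \<noteq> 2)"

section \<open>Orientable surfaces and genus\<close>

text \<open>The orientable surface of genus \<open>g\<close> is realised in three-space as the boundary
  of a handlebody: a rectangular plate pierced by \<open>g\<close> square holes in a row. For
  \<open>g = 0\<close> it is the boundary of a box, a sphere; for \<open>g = 1\<close> it is a torus.\<close>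

definition handlebody :: "nat \<Rightarrow> (real \<times> real \<times> real) set" where
  "handlebody g =
     {(x, y, z). 0 \<le> x \<and> x \<le> 2 * real g + 1 \<and> 0 \<le> y \<and> y \<le> 3 \<and> 0 \<le> z \<and> z \<le> 1 \<and>
        \<not> (\<exists>i<g. 2 * real i + 1 < x \<and> x < 2 * real i + 2 \<and> 1 < y \<and> y < 2)}"

definition orientable_surface :: "nat \<Rightarrow> (real \<times> real \<times> real) set" where
  "orientable_surface g = frontier (handlebody g)"

text \<open>An embedding sends vertices to distinct points and each edge to an arc joining
  the images of its endpoints; an arc contains no other vertex point, and two arcs
  meet at most in the images of common endpoints.\<close>

definition embeds_in :: "'v set \<Rightarrow> 'v set set \<Rightarrow> 'p::topological_space set \<Rightarrow> bool" where
  "embeds_in V E S \<longleftrightarrow>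
     (\<exists>(p :: 'v \<Rightarrow> 'p) (\<gamma> :: 'v set \<Rightarrow> real \<Rightarrow> 'p).
        inj_on p V \<and> p ` V \<subseteq> S \<and>
        (\<forall>e\<in>E. arc (\<gamma> e) \<and> path_image (\<gamma> e) \<subseteq> S \<and>
               {pathstart (\<gamma> e), pathfinish (\<gamma> e)} = p ` e \<and>
               path_image (\<gamma> e) \<inter> p ` V = p ` e) \<and>
        (\<forall>e\<in>E. \<forall>f\<in>E. e \<noteq> f \<longrightarrow>
               path_image (\<gamma> e) \<inter> path_image (\<gamma> f) \<subseteq> p ` (e \<inter> f)))"

text \<open>The infimum in \<^typ>\<open>enat\<close> is a minimum whenever some \<open>g\<close> works, as is the
  case for every finite graph; otherwise it would be \<open>\<infinity>\<close>.\<close>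

definition orientable_genus :: "'v set \<Rightarrow> 'v set set \<Rightarrow> enat" where
  "orientable_genus V E = (INF g \<in> {g. embeds_in V E (orientable_surface g)}. enat g)"

end

theory Submission
  imports Defs
begin

text \<open>The graph has vertices \<open>s\<^sub>0, \<dots>, s\<^sub>3\<close> and four groups consisting of a vertex \<open>v\<^sub>m\<close> and its four
  neighbours \<open>u\<^sub>k\<close>, \<open>k div 4 = m\<close>, whose other neighbours are three or four of the \<open>s\<^sub>j\<close>.
  Every edge contains exactly one \<open>u\<^sub>k\<close>, so a spanning tree \<open>T\<close> has \<open>23 = \<Sum>\<^sub>k deg\<^sub>T u\<^sub>k\<close>. Some
  \<open>T\<close>-neighbour \<open>u\<^sub>k\<close> of \<open>v\<^sub>m\<close> is not a leaf, since otherwise \<open>v\<^sub>m\<close> and its neighbours would be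
  a component of \<open>T\<close>; in a HIST it has degree at least \<open>3\<close>. One such vertex per group makes
  the sum at least \<open>16 + 4 * 2 = 24\<close>, a contradiction.

  For the embedding in genus \<open>16\<close>, hole \<open>k\<close> of the plate carries \<open>u\<^sub>k\<close> at the centre of its left
  wall. From there an edge runs straight to a point on the rim of that wall and then straight
  along the top or bottom of the plate. The front and back halves of these two sheets are four
  quarters. The vertex \<open>s\<^sub>j\<close> is the corner of the plate in quarter \<open>j\<close>; it sends no edge to the
  first three holes of group \<open>j\<close>, which leaves a free wedge there for \<open>v\<^sub>j\<close>.\<close>

section \<open>Trees\<close>

lemma graph_connected_crossing:
  assumes "graph_connected V E" "A \<inter> V \<noteq> {}" "\<not> V \<subseteq> A"
  obtains a b where "a \<in> A" "b \<notin> A" "{a, b} \<in> E"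
proof -
  obtain x y where xy: "x \<in> A" "x \<in> V" "y \<in> V" "y \<notin> A"
    using assms(2,3) by blast
  then have "(x, y) \<in> {(x, y). {x, y} \<in> E}\<^sup>*"
    using assms(1) by (auto simp: graph_connected_def)
  then have "y \<notin> A \<Longrightarrow> \<exists>a b. a \<in> A \<and> b \<notin> A \<and> {a, b} \<in> E"
    by (induction rule: rtrancl_induct) (use xy in auto)
  then show thesis
    using xy that by blast
qed

text \<open>Otherwise the first vertex of a longest path has a second edge, whose other end lies on
  the path by maximality; this closes a cycle.\<close>

lemma exists_degree_le_1:
  assumes G: "simple_graph V E" and ne: "V \<noteq> {}" and ac: "\<nexists>c. is_cycle E c"
  shows "\<exists>v\<in>V. degree E v \<le> 1"
proof (rule ccontr)
  assume "\<not> ?thesis"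
  then have deg2: "2 \<le> degree E v" if "v \<in> V" for v
    using that by fastforce
  have finV: "finite V" using G by (simp add: simple_graph_def)
  define P where "P xs \<longleftrightarrow> xs \<noteq> [] \<and> distinct xs \<and> set xs \<subseteq> V \<and>
    (\<forall>i. Suc i < length xs \<longrightarrow> {xs ! i, xs ! Suc i} \<in> E)" for xs
  have len: "length xs \<le> card V" if "P xs" for xs
    using that finV by (metis P_def card_mono distinct_card)
  obtain v0 where "v0 \<in> V" using ne by blast
  then have "P [v0]" by (simp add: P_def)
  then obtain xs where xs: "P xs" and max: "\<And>ys. P ys \<Longrightarrow> length ys \<le> length xs"
    using ex_has_greatest_nat[of P "[v0]" length "Suc (card V)"] len by (meson le_imp_less_Suc)
  have xs0: "xs ! 0 \<in> V" using xs by (auto simp: P_def)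
  \<comment> \<open>For a one-vertex path \<open>xs ! 1\<close> is unspecified, but the right-hand
    side is still a singleton, too small for degree 2.\<close>
  have "\<not> {e \<in> E. xs ! 0 \<in> e} \<subseteq> {{xs ! 0, xs ! 1}}"
  proof
    assume "{e \<in> E. xs ! 0 \<in> e} \<subseteq> {{xs ! 0, xs ! 1}}"
    then have "degree E (xs ! 0) \<le> card {{xs ! 0, xs ! 1}}"
      unfolding degree_def by (intro card_mono) auto
    with deg2[OF xs0] show False by simp
  qed
  then obtain e where e: "e \<in> E" "xs ! 0 \<in> e" "e \<noteq> {xs ! 0, xs ! 1}" by blast
  have "card e = 2" "e \<subseteq> V" using G e by (auto simp: simple_graph_def)
  then obtain y where y: "e = {xs ! 0, y}" "y \<noteq> xs ! 0" "y \<in> V"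
    using e(2) by (auto simp: card_2_iff doubleton_eq_iff)
  have "y \<in> set xs"
  proof (rule ccontr)
    assume "y \<notin> set xs"
    then have "P (y # xs)"
      using xs y e(1) unfolding P_def
      by (auto simp: nth_Cons insert_commute split: nat.split)
    from max[OF this] show False by simp
  qed
  then obtain j where j: "j < length xs" "xs ! j = y" by (auto simp: in_set_conv_nth)
  have "j \<noteq> 0" "j \<noteq> 1" using j y e(3) by (auto intro!: notI)
  then have j2: "2 \<le> j" by simp
  have "is_cycle E (take (Suc j) xs)"
    unfolding is_cycle_def
  proof (intro conjI allI impI)
    show "3 \<le> length (take (Suc j) xs)" using j2 j by simp
    show "distinct (take (Suc j) xs)" using xs by (simp add: P_def)
    fix i assume "i < length (take (Suc j) xs)"
    then have i: "i \<le> j" and l: "length (take (Suc j) xs) = Suc j" using j by auto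
    show "{take (Suc j) xs ! i, take (Suc j) xs ! (Suc i mod length (take (Suc j) xs))} \<in> E"
    proof (cases "i = j")
      case True
      then show ?thesis using e(1) y j unfolding l by (simp add: insert_commute)
    next
      case False
      then show ?thesis using i xs j unfolding l by (simp add: P_def)
    qed
  qed
  with ac show False by blast
qed

text \<open>Induction on the number of vertices: deleting a vertex of degree at most 1 loses at most
  one edge and creates no cycle.\<close>

lemma acyclic_card_edges:
  assumes "simple_graph V E" "V \<noteq> {}" "\<nexists>c. is_cycle E c"
  shows "card E < card V"
  using assms
proof (induction "card V" arbitrary: V E rule: less_induct)
  case less
  have fin: "finite V" using less.prems by (simp add: simple_graph_def)
  have finE: "finite E"
    using less.prems(1) by (auto simp: simple_graph_def intro: finite_subset[of _ "Pow V"])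
  obtain v where v: "v \<in> V" "degree E v \<le> 1"
    using exists_degree_le_1[OF less.prems] by blast
  define F where "F = {e \<in> E. v \<notin> e}"
  have "E = F \<union> {e \<in> E. v \<in> e}" by (auto simp: F_def)
  then have "card E \<le> card F + degree E v"
    unfolding degree_def using card_Un_le[of F "{e \<in> E. v \<in> e}"] by simp
  then have E: "card E \<le> card F + 1" using v by simp
  have cV: "card V = Suc (card (V - {v}))"
    using v fin by (metis card.remove)
  show ?case
  proof (cases "V = {v}")
    case True
    then have "E = {}"
      using less.prems(1) by (auto simp: simple_graph_def subset_singleton_iff)
    then show ?thesis using cV by simp
  next
    case False
    have "card F < card (V - {v})"
    proof (rule less.hyps)
      show "simple_graph (V - {v}) F" using less.prems(1) by (auto simp: simple_graph_def F_def)
      show "\<nexists>c. is_cycle F c" using less.prems(3) by (auto simp: is_cycle_def F_def)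
    qed (use cV False v in auto)
    then show ?thesis using E cV by simp
  qed
qed

section \<open>The graph\<close>

text \<open>Vertex \<open>j < 4\<close> is \<open>s\<^sub>j\<close>, vertex \<open>4 + m\<close> with \<open>m < 4\<close> is \<open>v\<^sub>m\<close>, and vertex \<open>8 + k\<close> with
  \<open>k < 16\<close> is \<open>u\<^sub>k\<close>. The pair \<open>(k, w)\<close> stands for the edge between \<open>u\<^sub>k\<close> and the vertex \<open>w < 8\<close>.
  The exceptional adjacency of \<open>u\<^sub>k\<close> to \<open>s\<^sub>m\<close> for \<open>k = 4 m + 3\<close> prevents the other three \<open>s\<^sub>j\<close> from
  separating group \<open>m\<close>.\<close>

definition pairs :: "(nat \<times> nat) set" where
  "pairs = {(k, w). k < 16 \<and> w < 8 \<and>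
     (if w < 4 then w \<noteq> k div 4 \<or> k mod 4 = 3 else w = 4 + k div 4)}"

definition verts :: "nat set" where
  "verts = {..<24}"

definition edges :: "nat set set" where
  "edges = (\<lambda>(k, w). {8 + k, w}) ` pairs"

lemma pairs_bounds: "(k, w) \<in> pairs \<Longrightarrow> k < 16 \<and> w < 8"
  by (simp add: pairs_def)

lemma edgesE:
  assumes "e \<in> edges"
  obtains k w where "(k, w) \<in> pairs" "e = {8 + k, w}"
  using assms by (auto simp: edges_def)

lemma edges_iff: "w < 8 \<Longrightarrow> {8 + k, w} \<in> edges \<longleftrightarrow> (k, w) \<in> pairs"
  by (auto simp: edges_def doubleton_eq_iff dest: pairs_bounds)

lemma simple_graph_edges: "simple_graph verts edges"
  unfolding simple_graph_def
proof (intro conjI ballI)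
  show "finite verts" by (simp add: verts_def)
  fix e assume "e \<in> edges"
  then obtain k w where kw: "(k, w) \<in> pairs" "e = {8 + k, w}" by (rule edgesE)
  then show "e \<subseteq> verts" "card e = 2" using pairs_bounds[OF kw(1)] by (auto simp: verts_def)
qed

section \<open>Degree count in a spanning tree\<close>

lemma no_HIST: "\<not> HIST verts edges T"
proof
  assume "HIST verts edges T"
  then have TE: "T \<subseteq> edges" and con: "graph_connected verts T"
    and sg: "simple_graph verts T" and ac: "\<nexists>c. is_cycle T c"
    and d2: "\<And>v. v \<in> verts \<Longrightarrow> degree T v \<noteq> 2"
    by (auto simp: HIST_def spanning_tree_def is_tree_def)
  have finT: "finite T"
    using sg by (auto simp: simple_graph_def intro: finite_subset[of _ "Pow verts"])
  \<comment> \<open>The stars at the \<open>u_k\<close> partition \<open>T\<close>: each edge has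
    exactly one end numbered 8 or more.\<close>
  have "T = (\<Union>k<16. {e \<in> T. 8 + k \<in> e})"
    using TE by (force elim!: edgesE dest: pairs_bounds)
  also have "card \<dots> = (\<Sum>k<16. degree T (8 + k))"
    unfolding degree_def
  proof (intro card_UN_disjoint ballI impI)
    fix i j :: nat assume "i \<noteq> j"
    then show "{e \<in> T. 8 + i \<in> e} \<inter> {e \<in> T. 8 + j \<in> e} = {}"
      using TE by (force elim!: edgesE dest: pairs_bounds)
  qed (use finT in auto)
  finally have cT: "card T = (\<Sum>k<16. degree T (8 + k))" .
  have d1: "1 \<le> degree T (8 + k)" if "k < 16" for k
  proof -
    have "8 + k \<in> verts" "0 \<in> verts - {8 + k}"
      using that by (auto simp: verts_def)
    then obtain b where "{8 + k, b} \<in> T"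
      using graph_connected_crossing[OF con, of "{8 + k}"] by blast
    then have "{e \<in> T. 8 + k \<in> e} \<noteq> {}" by blast
    then show ?thesis using finT by (simp add: degree_def Suc_le_eq card_gt_0_iff)
  qed
  have "\<exists>k<16. k div 4 = m \<and> 3 \<le> degree T (8 + k)" if m: "m < 4" for m
  proof -
    \<comment> \<open>\<open>A\<close> is \<open>v_m\<close> with its \<open>T\<close>-neighbours. A
      tree edge leaving \<open>A\<close> cannot start at \<open>v_m\<close>, so it gives some
      neighbour \<open>u_k\<close> a second tree edge.\<close>
    define A where "A = insert (4 + m) {x. {x, 4 + m} \<in> T}"
    have A8: "x \<in> A \<Longrightarrow> x = 4 + m \<or> (\<exists>k. x = 8 + k \<and> (k, 4 + m) \<in> pairs)" for x
      using TE m by (auto simp: A_def edges_def doubleton_eq_iff dest: pairs_bounds)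
    have "4 + m \<in> A \<inter> verts" "0 \<in> verts - A"
      using m A8[of 0] by (auto simp: A_def verts_def)
    then obtain a b where ab: "a \<in> A" "b \<notin> A" "{a, b} \<in> T"
      using graph_connected_crossing[OF con, of A] by blast
    then have "a \<noteq> 4 + m" by (auto simp: A_def insert_commute)
    then obtain k where k: "a = 8 + k" "(k, 4 + m) \<in> pairs" and aT: "{a, 4 + m} \<in> T"
      using A8[OF ab(1)] ab(1) by (auto simp: A_def)
    have "b \<noteq> 4 + m" using ab(2) by (auto simp: A_def)
    then have "card {{a, 4 + m}, {a, b}} = 2"
      by (auto simp: doubleton_eq_iff card_2_iff)
    moreover have "card {{a, 4 + m}, {a, b}} \<le> degree T a"
      unfolding degree_def using ab aT finT by (intro card_mono) auto
    moreover have "degree T a \<noteq> 2"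
      using d2[of a] k by (auto simp: verts_def pairs_def)
    ultimately have "3 \<le> degree T a" by simp
    moreover have "k < 16" "k div 4 = m" using k m by (auto simp: pairs_def)
    ultimately show ?thesis using k by blast
  qed
  then obtain h where h: "\<And>m. m < 4 \<Longrightarrow> h m < 16 \<and> h m div 4 = m \<and> 3 \<le> degree T (8 + h m)"
    by metis
  define K where "K = h ` {..<4}"
  have "inj_on h {..<4}" using h by (metis inj_onI lessThan_iff)
  then have cK: "card K = 4" by (simp add: K_def card_image)
  have K: "K \<subseteq> {..<16}" using h by (auto simp: K_def)
  have "(\<Sum>k<16. 1 + (if k \<in> K then 2 else 0)) \<le> (\<Sum>k<16. degree T (8 + k))"
    by (rule sum_mono) (use d1 h in \<open>auto simp: K_def\<close>)
  moreover have "(\<Sum>k<16. 1 + (if k \<in> K then 2 else 0)) = (24::nat)"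
    unfolding sum.distrib using K cK by (simp add: sum.If_cases Int_absorb1)
  moreover have "card T < card verts"
    by (rule acyclic_card_edges[OF sg _ ac]) (auto simp: verts_def lessThan_empty_iff)
  ultimately show False by (simp add: cT verts_def)
qed

section \<open>Connectivity after deleting at most three vertices\<close>

lemma four_connected: "k_connected 4 verts edges"
  unfolding k_connected_def
proof (intro conjI allI impI)
  show "4 < card verts" by (simp add: verts_def)
  fix S assume "S \<subseteq> verts \<and> card S < 4"
  then have SV: "S \<subseteq> verts" and S4: "card S < 4" by auto
  have finS: "finite S" using SV by (auto simp: verts_def intro: finite_subset)
  define R where "R = {(x, y). {x, y} \<in> {e \<in> edges. e \<subseteq> verts - S}}"
  have sym: "sym (R\<^sup>*)"
    by (rule sym_rtrancl) (auto simp: R_def sym_def insert_commute)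
  have step: "(8 + k, w) \<in> R\<^sup>*" if "(k, w) \<in> pairs" "8 + k \<notin> S" "w \<notin> S" for k w
  proof -
    have "{8 + k, w} \<in> edges" using that by (auto simp: edges_def)
    then show ?thesis
      using that pairs_bounds[OF that(1)] by (intro r_into_rtrancl) (auto simp: R_def verts_def)
  qed
  note step' = step[THEN symD[OF sym]]
  \<comment> \<open>Truncated subtraction sends every \<open>s_j\<close> to 0, which does no harm:
    fewer than four values are hit, and a missed value \<open>c\<close> still means that
    \<open>v_c\<close> and its neighbours survive. All other vertices get joined to
    \<open>v_c\<close>.\<close>
  define grp where "grp x = (if x < 8 then x - 4 else (x - 8) div 4)" for x :: nat
  have "card (grp ` S) < 4" using card_image_le[OF finS, of grp] S4 by simp
  then have "\<not> {..<4} \<subseteq> grp ` S"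
    using finS by (metis card_lessThan card_mono finite_imageI leD)
  then obtain c where c: "c < 4" "c \<notin> grp ` S" by auto
  have cv: "4 + c \<notin> S" using c imageI[of "4 + c" S grp] by (auto simp: grp_def)
  have cu: "8 + k \<notin> S" if "k div 4 = c" for k
    using c that imageI[of "8 + k" S grp] by (auto simp: grp_def)
  have s: "(j, 4 + c) \<in> R\<^sup>*" if "j < 4" "j \<notin> S" for j
  proof (rule rtrancl_trans)
    \<comment> \<open>\<open>u_r\<close> is the member of group \<open>c\<close> adjacent to all
      four \<open>s_j\<close>.\<close>
    define r where "r = 4 * c + 3"
    have r: "r div 4 = c" "r mod 4 = 3" unfolding r_def by presburger+
    with c(1) that have "(r, j) \<in> pairs" "(r, 4 + c) \<in> pairs"
      by (auto simp: pairs_def r_def)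
    with that cv cu[OF r(1)] show "(j, 8 + r) \<in> R\<^sup>*" "(8 + r, 4 + c) \<in> R\<^sup>*"
      by (blast intro: step step')+
  qed
  have u: "(8 + k, 4 + c) \<in> R\<^sup>*" if k: "k < 16" "8 + k \<notin> S" for k
  proof (cases "\<exists>j<4. j \<noteq> k div 4 \<and> j \<notin> S")
    case True
    then obtain j where j: "j < 4" "j \<noteq> k div 4" "j \<notin> S" by blast
    then have "(8 + k, j) \<in> R\<^sup>*" using k by (intro step) (auto simp: pairs_def)
    then show ?thesis using s[of j] j by (meson rtrancl_trans)
  next
    case False
    define m where "m = k div 4"
    have m: "m < 4" using k by (simp add: m_def)
    \<comment> \<open>The three other \<open>s_j\<close> use up \<open>S\<close>, so the walk can go
      through \<open>v_m\<close> and the exceptional \<open>u_r\<close> to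
      \<open>s_m\<close>.\<close>
    have sub: "{..<4} - {m} \<subseteq> S" using False by (auto simp: m_def)
    have "card ({..<4} - {m}) = 3" using m by simp
    then have eq: "S = {..<4} - {m}"
      using card_seteq[OF finS sub] S4 by simp
    define r where "r = 4 * m + 3"
    have "r div 4 = m" "r mod 4 = 3" unfolding r_def by presburger+
    with m k have "(k, 4 + m) \<in> pairs" "(r, 4 + m) \<in> pairs" "(r, m) \<in> pairs"
      by (auto simp: pairs_def m_def r_def)
    then have "(8 + k, 4 + m) \<in> R\<^sup>*" "(4 + m, 8 + r) \<in> R\<^sup>*" "(8 + r, m) \<in> R\<^sup>*"
      by (intro step step'; simp add: eq)+
    moreover have "(m, 4 + c) \<in> R\<^sup>*" using m by (intro s) (auto simp: eq)
    ultimately show ?thesis by (meson rtrancl_trans)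
  qed
  have v: "(4 + m, 4 + c) \<in> R\<^sup>*" if m: "m < 4" "4 + m \<notin> S" for m
  proof -
    have "card ((\<lambda>i. 8 + (4 * m + i)) ` {..<4}) = 4"
      by (simp add: card_image inj_on_def)
    then have "\<not> (\<lambda>i. 8 + (4 * m + i)) ` {..<4} \<subseteq> S"
      using S4 finS by (metis card_mono leD)
    then obtain i where i: "i < 4" "8 + (4 * m + i) \<notin> S" by auto
    have "(4 * m + i) div 4 = m" using i by simp
    with m i have "(4 * m + i, 4 + m) \<in> pairs" "4 * m + i < 16" by (auto simp: pairs_def)
    with m i have "(4 + m, 8 + (4 * m + i)) \<in> R\<^sup>*" "(8 + (4 * m + i), 4 + c) \<in> R\<^sup>*"
      by (intro step' u; simp)+
    then show ?thesis by (rule rtrancl_trans)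
  qed
  have all: "(x, 4 + c) \<in> R\<^sup>*" if x: "x \<in> verts - S" for x
  proof -
    consider "x < 4" | "4 \<le> x" "x < 8" | "8 \<le> x" by linarith
    then show ?thesis
    proof cases
      case 1 then show ?thesis using s x by simp
    next
      case 2 then show ?thesis using v[of "x - 4"] x by simp
    next
      case 3 then show ?thesis using u[of "x - 8"] x by (auto simp: verts_def)
    qed
  qed
  have "(x, y) \<in> R\<^sup>*" if "x \<in> verts - S" "y \<in> verts - S" for x y
    using all[OF that(1)] all[OF that(2), THEN symD[OF sym]] by (rule rtrancl_trans)
  moreover have "4 + c \<in> verts - S" using cv c by (simp add: verts_def)
  ultimately show "graph_connected (verts - S) {e \<in> edges. e \<subseteq> verts - S}"
    unfolding graph_connected_def R_def by blast
qed

section \<open>The embedding\<close>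

text \<open>Quarter \<open>j\<close> of the surface: \<open>j < 2\<close> selects the front and even \<open>j\<close> the top; \<open>h\<close> is the
  distance from the outer edge.\<close>

definition quarter :: "nat \<Rightarrow> real \<Rightarrow> real \<Rightarrow> real \<times> real \<times> real" where
  "quarter j x h = (x, if j < 2 then h else 3 - h, if even j then 1 else 0)"

definition post :: "nat \<Rightarrow> real \<times> real \<times> real" where
  "post k = (2 * real k + 1, 3 / 2, 1 / 2)"

text \<open>The last vertex \<open>u\<^sub>k\<close> of a group is joined both to \<open>s\<^sub>j\<close> and to \<open>v\<^sub>j\<close> in quarter \<open>j\<close>; the second
  edge crosses the rim at distance \<open>5 / 4\<close> instead of at the corner of the hole.\<close>

definition rim_h :: "nat \<Rightarrow> nat \<Rightarrow> real" where
  "rim_h k w = (if 4 \<le> w \<and> k mod 4 = 3 then 5 / 4 else 1)"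

definition rim :: "nat \<Rightarrow> nat \<Rightarrow> real \<times> real \<times> real" where
  "rim k w = quarter (w mod 4) (2 * real k + 1) (rim_h k w)"

text \<open>\<open>v_j\<close> is level with the right wall of hole \<open>4 j + 2\<close>. From
  there to \<open>x = 8 j + 7\<close> the plate is solid, so the edge to the last hole of the group
  may pass \<open>h = 1\<close>.\<close>

definition hub_x :: "nat \<Rightarrow> real" where
  "hub_x w = (if w < 4 then 0 else 8 * real (w mod 4) + 6)"

text \<open>A value below 1 keeps \<open>v_j\<close> off the holes; a value above 30/31 gives
  \<open>8 j + 6 < h * (8 j + 7)\<close> even for \<open>j = 3\<close>.\<close>

definition hub_h :: "nat \<Rightarrow> real" where
  "hub_h w = (if w < 4 then 0 else 31 / 32)"

definition hub :: "nat \<Rightarrow> real \<times> real \<times> real" where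
  "hub w = quarter (w mod 4) (hub_x w) (hub_h w)"

definition place :: "nat \<Rightarrow> real \<times> real \<times> real" where
  "place x = (if x < 8 then hub x else post (x - 8))"

definition curve :: "nat \<Rightarrow> nat \<Rightarrow> real \<Rightarrow> real \<times> real \<times> real" where
  "curve k w = linepath (post k) (rim k w) +++ linepath (rim k w) (hub w)"

section \<open>Coordinates and intersections of the curves\<close>

lemma post_eq_iff: "post k = post k' \<longleftrightarrow> k = k'"
  by (simp add: post_def)

lemma path_image_curve:
  "path_image (curve k w) = closed_segment (post k) (rim k w) \<union> closed_segment (rim k w) (hub w)"
  by (simp add: curve_def path_image_join)

text \<open>The front and back halves of a sheet meet at \<open>h = 3 / 2\<close>; the strict bounds
  keep them apart.\<close>

lemma quarter_inject:
  assumes "j < 4" "j' < 4" "h < 3 / 2" "h' < 3 / 2" "quarter j x h = quarter j' x' h'"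
  shows "j = j' \<and> x = x' \<and> h = h'"
proof -
  have "j < 2 \<longleftrightarrow> j' < 2" "even j \<longleftrightarrow> even j'"
    using assms(3-5) by (auto simp: quarter_def split: if_splits)
  moreover have "j \<in> {0, 1, 2, 3}" "j' \<in> {0, 1, 2, 3}" using assms(1,2) by auto
  ultimately have "j = j'" by auto
  then show ?thesis using assms(5) by (auto simp: quarter_def split: if_splits)
qed

lemma wall_cases:
  assumes "q \<in> closed_segment (post k) (rim k w)"
  obtains t where "0 \<le> t" "t \<le> 1"
    "q = (2 * real k + 1,
          3 / 2 + t * (if w mod 4 < 2 then rim_h k w - 3 / 2 else 3 / 2 - rim_h k w),
          1 / 2 + t * (if even w then 1 / 2 else - (1 / 2)))"
proof -
  have ev: "even (w mod 4) = even w" by presburger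
  obtain t where t: "0 \<le> t" "t \<le> 1" "q = (1 - t) *\<^sub>R post k + t *\<^sub>R rim k w"
    using assms by (auto simp: closed_segment_def)
  show thesis
    by (rule that[of t]) (use t in \<open>auto simp: post_def rim_def quarter_def ev field_simps\<close>)
qed

lemma sheet_cases:
  assumes "q \<in> closed_segment (rim k w) (hub w)"
  obtains t where "0 \<le> t" "t \<le> 1"
    "q = quarter (w mod 4) (hub_x w + t * (2 * real k + 1 - hub_x w))
           (hub_h w + t * (rim_h k w - hub_h w))"
proof -
  have "q \<in> closed_segment (hub w) (rim k w)" using assms by (simp add: closed_segment_commute)
  then obtain t where t: "0 \<le> t" "t \<le> 1" "q = (1 - t) *\<^sub>R hub w + t *\<^sub>R rim k w"
    by (auto simp: closed_segment_def)
  show thesis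
    by (rule that[of t]) (use t in \<open>auto simp: hub_def rim_def quarter_def algebra_simps\<close>)
qed

lemma spoke_cases:
  assumes "q \<in> closed_segment (rim k w) (hub w)" "w < 4"
  obtains t where "0 \<le> t" "t \<le> 1" "q = quarter w (t * (2 * real k + 1)) t"
  by (rule sheet_cases[OF assms(1)], rule that) (use assms(2) in \<open>auto simp: hub_x_def hub_h_def rim_h_def\<close>)

text \<open>For \<open>k = 4 j + i\<close> with \<open>j = w - 4\<close>, the displacement from
  \<open>v_j\<close> to the rim is \<open>2 i - 5\<close> in \<open>x\<close> and
  \<open>1 - 31 / 32\<close> or \<open>5 / 4 - 31 / 32\<close> in \<open>h\<close>.\<close>

lemma fan_cases:
  assumes "q \<in> closed_segment (rim k w) (hub w)" "(k, w) \<in> pairs" "4 \<le> w"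
  obtains t i where "0 \<le> t" "t \<le> 1" "i < 4" "k = 4 * (w - 4) + i" "w - 4 < 4"
    "q = quarter (w - 4) (8 * real (w - 4) + 6 + t * (2 * real i - 5))
           (31 / 32 + t * (if i = 3 then 9 / 32 else 1 / 32))"
proof -
  define j where "j = w - 4"
  have w: "w = 4 + j" "j < 4" "k div 4 = j" "w mod 4 = j"
    using assms(2,3) by (auto simp: j_def pairs_def)
  define i where "i = k mod 4"
  have k: "k = 4 * j + i" "i < 4" using w by (auto simp: i_def)
  obtain t where t: "0 \<le> t" "t \<le> 1"
    "q = quarter (w mod 4) (hub_x w + t * (2 * real k + 1 - hub_x w))
           (hub_h w + t * (rim_h k w - hub_h w))"
    by (rule sheet_cases[OF assms(1)])
  have x: "hub_x w = 8 * real j + 6" "2 * real k + 1 - (8 * real j + 6) = 2 * real i - 5"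
    using w k by (auto simp: hub_x_def)
  have h: "hub_h w = 31 / 32" "rim_h k w - 31 / 32 = (if i = 3 then 9 / 32 else 1 / 32)"
    using w by (auto simp: rim_h_def hub_h_def i_def)
  have "q = quarter j (8 * real j + 6 + t * (2 * real i - 5))
      (31 / 32 + t * (if i = 3 then 9 / 32 else 1 / 32))"
    using t(3) unfolding w(4) x h .
  then show thesis
    using that[of t i] t k w(2) unfolding j_def by blast
qed

lemma rim_h_bounds: "1 \<le> rim_h k w" "rim_h k w \<le> 5 / 4"
  by (auto simp: rim_h_def)

lemma hub_h_bounds: "0 \<le> hub_h w" "hub_h w < 1"
  by (auto simp: hub_h_def)

text \<open>The wedge between the edges from \<open>s\<^sub>w\<close> to the holes \<open>4 w - 1\<close> and \<open>4 w + 3\<close> is given by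
  \<open>h * (8 w - 1) < x < h * (8 w + 7)\<close>; the edges at \<open>v\<^sub>w\<close> lie inside it.\<close>

lemma fan_spoke_disjoint:
  assumes "(k, w) \<in> pairs" "(k', w') \<in> pairs" "w < 4" "w' = w + 4"
    "q \<in> closed_segment (rim k w) (hub w)" "q \<in> closed_segment (rim k' w') (hub w')"
  shows False
proof -
  obtain s where s: "0 \<le> s" "s \<le> 1" "q = quarter w (s * (2 * real k + 1)) s"
    by (rule spoke_cases[OF assms(5,3)])
  obtain t i where t: "0 \<le> t" "t \<le> 1" "i < 4"
    and "q = quarter (w' - 4) (8 * real (w' - 4) + 6 + t * (2 * real i - 5))
           (31 / 32 + t * (if i = 3 then 9 / 32 else 1 / 32))"
    by (rule fan_cases[OF assms(6,2)]) (use assms(4) in auto)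
  then have q: "q = quarter w (8 * real w + 6 + t * (2 * real i - 5))
           (31 / 32 + t * (if i = 3 then 9 / 32 else 1 / 32))"
    using assms(4) by simp
  have "31 / 32 + t * (if i = 3 then 9 / 32 else 1 / 32) < 3 / 2" using t by auto
  then have h: "s = 31 / 32 + t * (if i = 3 then 9 / 32 else 1 / 32)"
    and x: "s * (2 * real k + 1) = 8 * real w + 6 + t * (2 * real i - 5)"
    using quarter_inject[OF assms(3,3) _ _ trans[OF s(3)[symmetric] q]] s by auto
  have i: "i \<in> {0, 1, 2, 3}" and w: "w \<in> {0, 1, 2, 3}" using t(3) assms(3) by auto
  \<comment> \<open>\<open>s_w\<close> has no edge to the holes \<open>4 w\<close>,
    \<open>4 w + 1\<close>, \<open>4 w + 2\<close>, so its edges stay on or outside the sides of the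
    wedge.\<close>
  have "w \<noteq> k div 4 \<or> k mod 4 = 3" using assms(1,3) by (simp add: pairs_def)
  then have "k + 1 \<le> 4 * w \<or> 4 * w + 3 \<le> k" by presburger
  then have "2 * real k + 1 \<le> 8 * real w - 1 \<or> 8 * real w + 7 \<le> 2 * real k + 1" by linarith
  then have "s * (2 * real k + 1) \<le> s * (8 * real w - 1) \<or> s * (8 * real w + 7) \<le> s * (2 * real k + 1)"
    using s(1) mult_left_mono by metis
  \<comment> \<open>For numerals \<open>i\<close> and \<open>w\<close> the sides of the wedge are
    affine in \<open>t\<close>, which leaves linear arithmetic.\<close>
  then show False
    unfolding x using i w t(1,2) h by (elim disjE insertE emptyE) (simp_all add: algebra_simps)
qed

lemma mod_4_cases:
  fixes w w' :: nat
  assumes "w < 8" "w' < 8" "w mod 4 = w' mod 4"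
  obtains "w = w'" | "w < 4" "w' = w + 4" | "w' < 4" "w = w' + 4"
proof -
  have "w div 4 = 0 \<or> w div 4 = 1" "w' div 4 = 0 \<or> w' div 4 = 1" using assms by auto
  moreover have "w = 4 * (w div 4) + w mod 4" "w' = 4 * (w' div 4) + w' mod 4" "w mod 4 < 4"
    by simp_all
  ultimately show thesis using that assms(3) by fastforce
qed

text \<open>Distinct quarters do not meet below the midline. Within one, edges from a corner have
  distinct slopes, edges at \<open>v_j\<close> have distinct directions, and the wedge separates the
  two kinds.\<close>

lemma sheets_disjoint:
  assumes kw: "(k, w) \<in> pairs" and kw': "(k', w') \<in> pairs" and ne: "(k, w) \<noteq> (k', w')"
    and q: "q \<in> closed_segment (rim k w) (hub w)" "q \<in> closed_segment (rim k' w') (hub w')"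
  shows "w = w' \<and> q = hub w"
proof -
  have lt: "hub_h w + t * (rim_h k w - hub_h w) < 3 / 2" if "0 \<le> t" "t \<le> 1" for t k w
  proof -
    have "t * (rim_h k w - hub_h w) \<le> 1 * (rim_h k w - hub_h w)"
      using that rim_h_bounds[of k w] hub_h_bounds[of w] by (intro mult_right_mono) auto
    then show ?thesis using rim_h_bounds[of k w] by simp
  qed
  have "w mod 4 = w' mod 4"
  proof (rule sheet_cases[OF q(1)], rule sheet_cases[OF q(2)])
    fix s t :: real
    assume *: "0 \<le> s" "s \<le> 1" "0 \<le> t" "t \<le> 1"
      "q = quarter (w mod 4) (hub_x w + s * (2 * real k + 1 - hub_x w))
         (hub_h w + s * (rim_h k w - hub_h w))"
      "q = quarter (w' mod 4) (hub_x w' + t * (2 * real k' + 1 - hub_x w'))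
         (hub_h w' + t * (rim_h k' w' - hub_h w'))"
    show ?thesis
      using quarter_inject[OF _ _ lt[OF *(1,2)] lt[OF *(3,4)] trans[OF *(5)[symmetric] *(6)]] by simp
  qed
  then consider "w = w'" "w < 4" | "w = w'" "4 \<le> w" | "w < 4" "w' = w + 4" | "w' < 4" "w = w' + 4"
    using pairs_bounds[OF kw] pairs_bounds[OF kw'] by (metis mod_4_cases not_less)
  then show ?thesis
  proof cases
    case 1
    obtain s where s: "0 \<le> s" "s \<le> 1" "q = quarter w (s * (2 * real k + 1)) s"
      by (rule spoke_cases[OF q(1) 1(2)])
    obtain t where t: "0 \<le> t" "t \<le> 1" "q = quarter w (t * (2 * real k' + 1)) t"
      by (rule spoke_cases[OF q(2)[folded 1(1)] 1(2)])
    have "s = t" "s * (2 * real k + 1) = t * (2 * real k' + 1)"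
      using quarter_inject[OF 1(2) 1(2) _ _ trans[OF s(3)[symmetric] t(3)]] s t by auto
    moreover have "k \<noteq> k'" using ne 1 by simp
    ultimately have "s = 0" by auto
    then show ?thesis using s 1 by (simp add: hub_def hub_x_def hub_h_def)
  next
    case 2
    obtain s i where s: "0 \<le> s" "s \<le> 1" "i < 4" "k = 4 * (w - 4) + i" "w - 4 < 4"
      "q = quarter (w - 4) (8 * real (w - 4) + 6 + s * (2 * real i - 5))
           (31 / 32 + s * (if i = 3 then 9 / 32 else 1 / 32))"
      by (rule fan_cases[OF q(1) kw 2(2)])
    obtain t i' where t: "0 \<le> t" "t \<le> 1" "i' < 4" "k' = 4 * (w - 4) + i'"
      "q = quarter (w - 4) (8 * real (w - 4) + 6 + t * (2 * real i' - 5))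
           (31 / 32 + t * (if i' = 3 then 9 / 32 else 1 / 32))"
      by (rule fan_cases[OF q(2)[folded 2(1)] kw'[folded 2(1)] 2(2)])
    have "i \<noteq> i'" using ne 2 s t by auto
    moreover have "s * (2 * real i - 5) = t * (2 * real i' - 5)"
      "s * (if i = 3 then 9 / 32 else 1 / 32) = t * (if i' = 3 then 9 / 32 else 1 / 32)"
      using quarter_inject[OF s(5) s(5) _ _ trans[OF s(6)[symmetric] t(5)]] s t by auto
    moreover have "i \<in> {0, 1, 2, 3}" "i' \<in> {0, 1, 2, 3}" using s t by auto
    \<comment> \<open>With \<open>h\<close> scaled by 32 the directions are (-5, 1), (-3, 1), (-1,
      1), (1, 9), no two of them parallel.\<close>
    ultimately have "s = 0" using s(1,2) t(1,2) by auto
    moreover have "w mod 4 = w - 4" using s(5) 2 by presburger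
    ultimately show ?thesis using s 2 by (simp add: hub_def hub_x_def hub_h_def)
  next
    case 3
    then show ?thesis using fan_spoke_disjoint[OF kw kw'] q by blast
  next
    case 4
    then show ?thesis using fan_spoke_disjoint[OF kw' kw] q by blast
  qed
qed

text \<open>On a wall segment the height is strictly between 0 and 1 except at the rim end, while
  sheets have height 0 or 1.\<close>

lemma wall_sheet:
  assumes "q \<in> closed_segment (post k) (rim k w)" "q \<in> closed_segment (rim k' w') (hub w')"
  shows "q = rim k w"
proof -
  obtain t where t: "0 \<le> t" "t \<le> 1"
    "q = (2 * real k + 1,
          3 / 2 + t * (if w mod 4 < 2 then rim_h k w - 3 / 2 else 3 / 2 - rim_h k w),
          1 / 2 + t * (if even w then 1 / 2 else - (1 / 2)))"
    by (rule wall_cases[OF assms(1)])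
  have "snd (snd q) = 1 \<or> snd (snd q) = 0"
    by (rule sheet_cases[OF assms(2)]) (simp add: quarter_def)
  then have "t = 1" using t by (auto split: if_splits)
  moreover have "even (w mod 4) = even w" by presburger
  ultimately show ?thesis using t by (auto simp: rim_def quarter_def)
qed

lemma walls_disjoint:
  assumes kw: "(k, w) \<in> pairs" and kw': "(k', w') \<in> pairs" and ne: "(k, w) \<noteq> (k', w')"
    and q: "q \<in> closed_segment (post k) (rim k w)" "q \<in> closed_segment (post k') (rim k' w')"
  shows "k = k' \<and> q = post k"
proof -
  obtain s where s: "0 \<le> s" "s \<le> 1"
    "q = (2 * real k + 1,
          3 / 2 + s * (if w mod 4 < 2 then rim_h k w - 3 / 2 else 3 / 2 - rim_h k w),
          1 / 2 + s * (if even w then 1 / 2 else - (1 / 2)))"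
    by (rule wall_cases[OF q(1)])
  obtain t where t: "0 \<le> t" "t \<le> 1"
    "q = (2 * real k' + 1,
          3 / 2 + t * (if w' mod 4 < 2 then rim_h k' w' - 3 / 2 else 3 / 2 - rim_h k' w'),
          1 / 2 + t * (if even w' then 1 / 2 else - (1 / 2)))"
    by (rule wall_cases[OF q(2)])
  have k: "k = k'" using s t by simp
  have "s = 0"
  proof (rule ccontr)
    assume "s \<noteq> 0"
    have z: "s * (if even w then 1 / 2 else - (1 / 2)) = t * (if even w' then 1 / 2 else - (1 / 2))"
      and y: "s * (if w mod 4 < 2 then rim_h k w - 3 / 2 else 3 / 2 - rim_h k w) =
        t * (if w' mod 4 < 2 then rim_h k w' - 3 / 2 else 3 / 2 - rim_h k w')"
      using s t k by auto
    have ev: "even w \<longleftrightarrow> even w'" and st: "s = t"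
      using z s t \<open>s \<noteq> 0\<close> by (auto split: if_splits)
    have "(if w mod 4 < 2 then rim_h k w - 3 / 2 else 3 / 2 - rim_h k w) =
        (if w' mod 4 < 2 then rim_h k w' - 3 / 2 else 3 / 2 - rim_h k w')"
      using y \<open>s \<noteq> 0\<close> unfolding st by simp
    then have "(w mod 4 < 2 \<longleftrightarrow> w' mod 4 < 2)" and h: "rim_h k w = rim_h k w'"
      using rim_h_bounds[of k w] rim_h_bounds[of k w'] by (auto split: if_splits)
    with ev have "w mod 4 = w' mod 4" by presburger
    moreover have "w \<noteq> w'" using ne k by simp
    ultimately have "w < 4 \<and> w' = w + 4 \<or> w' < 4 \<and> w = w' + 4"
      using pairs_bounds[OF kw] pairs_bounds[OF kw'] by (metis mod_4_cases)
    \<comment> \<open>\<open>s_j\<close> and \<open>v_j\<close> are both adjacent to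
      \<open>u_k\<close> only if \<open>k mod 4 = 3\<close>, and then the rim distances are 1 and
      5/4.\<close>
    then show False using kw kw' h k by (auto simp: pairs_def rim_h_def)
  qed
  then show ?thesis using s k by (simp add: post_def)
qed

lemma curves_disjoint:
  assumes kw: "(k, w) \<in> pairs" and kw': "(k', w') \<in> pairs" and ne: "(k, w) \<noteq> (k', w')"
    and q: "q \<in> path_image (curve k w)" "q \<in> path_image (curve k' w')"
  shows "q \<in> place ` ({8 + k, w} \<inter> {8 + k', w'})"
proof -
  have sheets: ?thesis
    if "q \<in> closed_segment (rim k w) (hub w)" "q \<in> closed_segment (rim k' w') (hub w')"
    using sheets_disjoint[OF kw kw' ne that] pairs_bounds[OF kw] by (auto simp: place_def)
  consider
      "q \<in> closed_segment (post k) (rim k w)" "q \<in> closed_segment (post k') (rim k' w')"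
    | "q \<in> closed_segment (post k) (rim k w)" "q \<in> closed_segment (rim k' w') (hub w')"
    | "q \<in> closed_segment (rim k w) (hub w)" "q \<in> closed_segment (post k') (rim k' w')"
    | "q \<in> closed_segment (rim k w) (hub w)" "q \<in> closed_segment (rim k' w') (hub w')"
    using q unfolding path_image_curve by blast
  then show ?thesis
  proof cases
    case 1
    from walls_disjoint[OF kw kw' ne this] show ?thesis by (simp add: place_def)
  next
    case 2
    \<comment> \<open>The point is the rim point of the first curve, where its sheet segment starts,
      so two sheet segments meet.\<close>
    with wall_sheet[OF 2] show ?thesis by (intro sheets) simp_all
  next
    case 3
    with wall_sheet[OF 3(2,1)] show ?thesis by (intro sheets) simp_all
  next
    case 4
    then show ?thesis by (rule sheets)
  qed
qed

lemma arc_curve: "arc (curve k w)"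
  unfolding curve_def
proof (rule arc_join)
  show "arc (linepath (post k) (rim k w))"
    by (rule arc_linepath) (simp add: post_def rim_def quarter_def)
  show "arc (linepath (rim k w) (hub w))"
    using rim_h_bounds[of k w] hub_h_bounds[of w]
    by (intro arc_linepath) (auto simp: hub_def rim_def quarter_def)
  show "path_image (linepath (post k) (rim k w)) \<inter> path_image (linepath (rim k w) (hub w))
      \<subseteq> {pathstart (linepath (rim k w) (hub w))}"
    using wall_sheet by auto
qed simp

lemma inj_on_place: "inj_on place verts"
proof (rule inj_onI)
  fix x y assume xy: "x \<in> verts" "y \<in> verts" "place x = place y"
  have hub: "hub w \<noteq> post k" for w k by (simp add: hub_def quarter_def post_def)
  show "x = y"
  proof (cases "x < 8 \<and> y < 8")
    case True
    then have "x mod 4 = y mod 4 \<and> hub_x x = hub_x y \<and> hub_h x = hub_h y"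
      using xy hub_h_bounds[of x] hub_h_bounds[of y]
      by (intro quarter_inject) (auto simp: place_def hub_def)
    then have m: "x mod 4 = y mod 4" and h: "x < 4 \<longleftrightarrow> y < 4"
      by (auto simp: hub_h_def split: if_splits)
    show ?thesis
      by (rule mod_4_cases[OF conjunct1[OF True] conjunct2[OF True] m]) (use h in auto)
  next
    case False
    then show ?thesis
      using xy(3) hub hub[symmetric]
      by (cases "x < 8"; cases "y < 8") (simp_all add: place_def post_eq_iff)
  qed
qed

section \<open>Points of the surface, recognised by a direction that leaves the handlebody\<close>

lemma frontierI_exit:
  fixes p d :: "'a::real_normed_vector"
  assumes p: "p \<in> S" and d: "\<And>t. 0 < t \<Longrightarrow> t < 1 \<Longrightarrow> p + t *\<^sub>R d \<notin> S"
  shows "p \<in> frontier S"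
  unfolding frontier_straddle
proof (intro allI impI conjI)
  fix e :: real assume e: "0 < e"
  then show "\<exists>x\<in>S. dist p x < e" using p by (intro bexI[of _ p]) simp
  define t where "t = min (1 / 2) (e / (2 * (norm d + 1)))"
  have n: "0 < norm d + 1" by (simp add: add_nonneg_pos)
  have t: "0 < t" "t < 1" using e n by (auto simp: t_def)
  have "t * norm d \<le> t * (norm d + 1)" using t by simp
  also have "\<dots> \<le> e / (2 * (norm d + 1)) * (norm d + 1)"
    using n by (intro mult_right_mono) (auto simp: t_def)
  also have "\<dots> < e" using n e by (simp add: field_simps add_pos_nonneg)
  finally have "dist p (p + t *\<^sub>R d) < e" using t by (simp add: dist_norm)
  then show "\<exists>x. x \<notin> S \<and> dist p x < e" using d[OF t] by blast
qed

text \<open>The exit is straight up or down. The last hypothesis keeps the point out of the holes: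
  it lies outside their row or on a solid bar.\<close>

lemma sheet_in_surface:
  assumes "0 \<le> x" "x \<le> 33" "0 \<le> h" "h \<le> 3 / 2" "h \<le> 1 \<or> (\<exists>k. 2 * real k \<le> x \<and> x \<le> 2 * real k + 1)"
  shows "quarter j x h \<in> orientable_surface 16"
  unfolding orientable_surface_def
proof (rule frontierI_exit)
  have "\<not> (2 * real i + 1 < x \<and> x < 2 * real i + 2 \<and> 1 < h)" for i
  proof
    assume *: "2 * real i + 1 < x \<and> x < 2 * real i + 2 \<and> 1 < h"
    then obtain k where "2 * real k \<le> x" "x \<le> 2 * real k + 1" using assms(5) by auto
    with * have "real i < real k" "real k < real (Suc i)" by auto
    then show False unfolding of_nat_less_iff by simp
  qed
  then show "quarter j x h \<in> handlebody 16"
    using assms by (auto simp: handlebody_def quarter_def)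
  show "quarter j x h + t *\<^sub>R (0, 0, if even j then 1 else - 1) \<notin> handlebody 16" if "0 < t" "t < 1" for t
    using that by (auto simp: handlebody_def quarter_def)
qed

lemma wall_in_surface:
  assumes "k < 16" "1 \<le> y" "y \<le> 2" "0 \<le> z" "z \<le> 1"
  shows "(2 * real k + 1, y, z) \<in> orientable_surface 16"
  unfolding orientable_surface_def
proof (rule frontierI_exit)
  have "\<not> (2 * real i + 1 < 2 * real k + 1 \<and> 2 * real k + 1 < 2 * real i + 2)" for i
  proof
    assume "2 * real i + 1 < 2 * real k + 1 \<and> 2 * real k + 1 < 2 * real i + 2"
    then have "real i < real k" "real k < real (Suc i)" by auto
    then show False unfolding of_nat_less_iff by simp
  qed
  then show "(2 * real k + 1, y, z) \<in> handlebody 16"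
    using assms by (auto simp: handlebody_def)
  fix t :: real assume t: "0 < t" "t < 1"
  \<comment> \<open>The exit into hole \<open>k\<close> drifts towards the midline, so that points
    with \<open>y = 1\<close> or \<open>y = 2\<close> also enter the open hole.\<close>
  have "0 \<le> (1 - t) * (2 - y)" "0 \<le> (1 - t) * (y - 1)" using t assms(2,3) by simp_all
  then have "1 < y + t * (3 / 2 - y) \<and> y + t * (3 / 2 - y) < 2"
    using t(1) by (simp add: algebra_simps)
  then show "(2 * real k + 1, y, z) + t *\<^sub>R (1, 3 / 2 - y, 0) \<notin> handlebody 16"
    using t assms by (auto simp: handlebody_def intro!: exI[of _ k])
qed

lemma curve_in_surface:
  assumes kw: "(k, w) \<in> pairs"
  shows "path_image (curve k w) \<subseteq> orientable_surface 16"
proof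
  fix q assume "q \<in> path_image (curve k w)"
  then consider "q \<in> closed_segment (post k) (rim k w)" | "q \<in> closed_segment (rim k w) (hub w)"
    by (auto simp: path_image_curve)
  then show "q \<in> orientable_surface 16"
  proof cases
    case 1
    then obtain t where t: "0 \<le> t" "t \<le> 1"
      "q = (2 * real k + 1,
            3 / 2 + t * (if w mod 4 < 2 then rim_h k w - 3 / 2 else 3 / 2 - rim_h k w),
            1 / 2 + t * (if even w then 1 / 2 else - (1 / 2)))"
      by (rule wall_cases)
    have "\<bar>t * (if w mod 4 < 2 then rim_h k w - 3 / 2 else 3 / 2 - rim_h k w)\<bar> \<le> 1 * (1 / 2)"
      unfolding abs_mult using t rim_h_bounds[of k w] by (intro mult_mono) auto
    then show ?thesis
      unfolding t(3) using t(1,2) pairs_bounds[OF kw] by (intro wall_in_surface) auto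
  next
    case 2
    show ?thesis
    proof (cases "w < 4")
      case True
      obtain t where t: "0 \<le> t" "t \<le> 1" "q = quarter w (t * (2 * real k + 1)) t"
        by (rule spoke_cases[OF 2 True])
      have "t * (2 * real k + 1) \<le> 1 * 33"
        using t pairs_bounds[OF kw] by (intro mult_mono) auto
      then show ?thesis
        unfolding t(3) using t pairs_bounds[OF kw] by (intro sheet_in_surface) auto
    next
      case False
      obtain t i where t: "0 \<le> t" "t \<le> 1" "i < 4" "w - 4 < 4"
        and q: "q = quarter (w - 4) (8 * real (w - 4) + 6 + t * (2 * real i - 5))
           (31 / 32 + t * (if i = 3 then 9 / 32 else 1 / 32))"
        by (rule fan_cases[OF 2 kw]) (use False in auto)
      have x: "- 5 * t \<le> t * (2 * real i - 5)" "t * (2 * real i - 5) \<le> t * 1"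
        using t by (auto simp: algebra_simps mult_left_mono)
      have w: "real (w - 4) \<le> 3" using t(4) by linarith
      show ?thesis
        unfolding q
      proof (rule sheet_in_surface)
        show "31 / 32 + t * (if i = 3 then 9 / 32 else 1 / 32) \<le> 1 \<or>
          (\<exists>k. 2 * real k \<le> 8 * real (w - 4) + 6 + t * (2 * real i - 5) \<and>
               8 * real (w - 4) + 6 + t * (2 * real i - 5) \<le> 2 * real k + 1)"
        proof (cases "i = 3")
          case True
          \<comment> \<open>With \<open>j = w - 4\<close>, this edge stays in
            \<open>8 j + 6 \<le> x \<le> 8 j + 7\<close>, the bar left of hole
            \<open>4 j + 3\<close>.\<close>
          then show ?thesis using t by (intro disjI2 exI[of _ "4 * (w - 4) + 3"]) auto
        qed (use t in auto)
        show "0 \<le> 8 * real (w - 4) + 6 + t * (2 * real i - 5)"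
          "8 * real (w - 4) + 6 + t * (2 * real i - 5) \<le> 33"
          using t(1,2) x w of_nat_0_le_iff[of "w - 4"] by linarith+
      qed (use t(1,2) in auto)
    qed
  qed
qed

text \<open>Since every vertex is an end of some edge, its position on the surface and off the other
  arcs follows from facts about arcs.\<close>

lemma edges_cover:
  assumes "y \<in> verts"
  obtains e where "e \<in> edges" "y \<in> e"
proof -
  have edge: "{8 + k, w} \<in> edges" if "(k, w) \<in> pairs" for k w
    using that pairs_bounds[OF that] by (simp add: edges_iff)
  consider "y < 4" | "4 \<le> y" "y < 8" | "8 \<le> y" by linarith
  then show thesis
  proof cases
    case 1
    then have "(4 * y + 3, y) \<in> pairs" by (simp add: pairs_def)
    from that[OF edge[OF this]] show thesis by blast
  next
    case 2
    then have "(4 * (y - 4), y) \<in> pairs" by (simp add: pairs_def)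
    from that[OF edge[OF this]] show thesis by blast
  next
    case 3
    with assms have "(y - 8, 4 + (y - 8) div 4) \<in> pairs" by (auto simp: pairs_def verts_def)
    from that[OF edge[OF this]] 3 show thesis by simp
  qed
qed

lemma embeds: "embeds_in verts edges (orientable_surface 16)"
proof -
  \<comment> \<open>As \<open>w < 8 \<le> 8 + k\<close>, the maximum and minimum of an edge recover
    its pair.\<close>
  define \<gamma> where "\<gamma> e = curve (Max e - 8) (Min e)" for e
  have \<gamma>: "\<gamma> {8 + k, w} = curve k w" if "(k, w) \<in> pairs" for k w
    using pairs_bounds[OF that] by (simp add: \<gamma>_def)
  have ends: "{pathstart (curve k w), pathfinish (curve k w)} = place ` {8 + k, w}"
    if "(k, w) \<in> pairs" for k w
    using pairs_bounds[OF that] by (simp add: curve_def place_def)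
  have dis: "path_image (\<gamma> e) \<inter> path_image (\<gamma> f) \<subseteq> place ` (e \<inter> f)"
    if ef: "e \<in> edges" "f \<in> edges" "e \<noteq> f" for e f
  proof -
    obtain k w where e: "(k, w) \<in> pairs" "e = {8 + k, w}" using ef(1) by (rule edgesE)
    obtain k' w' where f: "(k', w') \<in> pairs" "f = {8 + k', w'}" using ef(2) by (rule edgesE)
    show ?thesis
      using curves_disjoint[OF e(1) f(1)] ef(3) unfolding e(2) f(2) \<gamma>[OF e(1)] \<gamma>[OF f(1)] by blast
  qed
  have \<gamma>e: "arc (\<gamma> e) \<and> path_image (\<gamma> e) \<subseteq> orientable_surface 16 \<and>
      {pathstart (\<gamma> e), pathfinish (\<gamma> e)} = place ` e" if ed: "e \<in> edges" for e
  proof -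
    obtain k w where e: "(k, w) \<in> pairs" "e = {8 + k, w}" using ed by (rule edgesE)
    show ?thesis
      unfolding e(2) \<gamma>[OF e(1)] using arc_curve curve_in_surface[OF e(1)] ends[OF e(1)] by blast
  qed
  have pe: "place ` e \<subseteq> path_image (\<gamma> e)" if "e \<in> edges" for e
  proof -
    have "{pathstart (\<gamma> e), pathfinish (\<gamma> e)} \<subseteq> path_image (\<gamma> e)"
      by (simp add: pathstart_in_path_image pathfinish_in_path_image)
    with \<gamma>e[OF that] show ?thesis by simp
  qed
  have sub: "e \<subseteq> verts" if "e \<in> edges" for e
    using that simple_graph_edges by (auto simp: simple_graph_def)
  have vert: "path_image (\<gamma> e) \<inter> place ` verts = place ` e" if e: "e \<in> edges" for e
  proof -
    have "y \<in> e" if y: "y \<in> verts" "place y \<in> path_image (\<gamma> e)" for y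
    proof (rule ccontr)
      assume "y \<notin> e"
      \<comment> \<open>An edge \<open>f\<close> at \<open>y\<close> meets the arc of
        \<open>e\<close> only in images of common vertices, and injectivity makes \<open>y\<close>
        one of them.\<close>
      obtain f where f: "f \<in> edges" "y \<in> f" using edges_cover[OF y(1)] .
      have "place y \<in> path_image (\<gamma> f)" using pe[OF f(1)] f(2) by blast
      moreover have "e \<noteq> f" using f(2) \<open>y \<notin> e\<close> by blast
      ultimately obtain z where z: "z \<in> e" "place y = place z"
        using dis[OF e f(1)] y(2) by blast
      then have "y = z" using inj_onD[OF inj_on_place] sub[OF e] y(1) by blast
      with z(1) \<open>y \<notin> e\<close> show False by simp
    qed
    with pe[OF e] image_mono[OF sub[OF e], of place] show ?thesis by auto
  qed
  have surf: "place ` verts \<subseteq> orientable_surface 16"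
  proof
    fix q assume "q \<in> place ` verts"
    then obtain y where y: "y \<in> verts" "q = place y" by blast
    obtain e where e: "e \<in> edges" "y \<in> e" using edges_cover[OF y(1)] .
    then show "q \<in> orientable_surface 16" using pe[OF e(1)] \<gamma>e[OF e(1)] y(2) by auto
  qed
  show ?thesis
    unfolding embeds_in_def
    by (intro exI[of _ place] exI[of _ \<gamma>] conjI ballI impI inj_on_place surf vert dis)
      (simp_all add: \<gamma>e)
qed

theorem theorem5:
  shows "\<exists>(V :: nat set) E.
           simple_graph V E \<and> k_connected 4 V E \<and> orientable_genus V E \<le> 39 \<and>
           \<not> (\<exists>T. HIST V E T)"
proof -
  have "orientable_genus verts edges \<le> enat 16"
    unfolding orientable_genus_def using embeds by (intro INF_lower) simp
  also have "enat 16 \<le> 39" by (simp add: numeral_eq_enat)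
  finally show ?thesis
    using simple_graph_edges four_connected no_HIST by blast
qed

end
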